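(* For all nonnegative integers $n,k$ with $0\le k\le n$, \[ \sum_{\pi \in \mathfrak{S}_{n}^k}q^{{\rm inv}(\pi)}\prod_{i \in {\rm Des}(\pi)}\left(1+\frac{z}{q^{1+{\rm inv}^{\Box,i}(\pi)}}\right) = \sum_{\pi \in \mathfrak{S}_{n}^k}q^{{\rm maj}(\pi)}\prod_{i=1}^{{\rm des}(\pi)}\left(1+\frac{z}{q^{i}} \right), \] where $q,z$ are indeterminates.
   Context: A partial permutation (Laguerre word) in $\mathfrak{S}_n^k$ is a word $\pi=\pi_1\pi_2\cdots\pi_n$ of length $n$ in which exactly $k$ letters are a hole symbol $\lozenge$ and the other $n-k$ letters are distinct elements of $[n]=\{1,\dots,n\}$. Letters are ordered $1<2<\cdots<n<\lozenge$. Let $S_\pi\subseteq[n]$ be the set of numerical letters of $\pi$ and $\overline S_\pi=[n]\setminus S_\pi$. For disjoint sets $A,B$ of integers, ${\rm inv}(A,B)=|\{(a,b)\in A\times B: a>b\}|$. For $i\in[n]$, ${\rm inv}^{\Box,i}(\pi)=|\{j: 1\le j<i,\ \pi_j>\pi_i\}|$, and ${\rm inv}_0(\pi)=\sum_{i=1}^n {\rm inv}^{\Box,i}(\pi)$. The descent set is ${\rm Des}(\pi)=\{i\in[n-1]:\pi_i>\pi_{i+1}\}$, ${\rm des}(\pi)=|{\rm Des}(\pi)|$, and ${\rm maj}_0(\pi)=\sum_{i\in{\rm Des}(\pi)} i$. Define ${\rm inv}(\pi)={\rm inv}_0(\pi)+{\rm inv}(S_\pi,\overline S_\pi)$ and ${\rm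 maj}(\pi)={\rm maj}_0(\pi)+{\rm inv}(S_\pi,\overline S_\pi)$. *)

theory Defs
  imports
    "HOL-Library.Extended_Nat"
    "HOL-Computational_Algebra.Polynomial"
    "HOL-Computational_Algebra.Fraction_Field"
begin

text \<open>
  Letters are elements of \<^typ>\<open>enat\<close>: the number \<open>i\<close> is \<open>enat i\<close>, and the hole is
  \<open>\<infinity>\<close>, so that the order of \<^typ>\<open>enat\<close> is the order \<open>1 < 2 < \<dots> < n < hole\<close>, and two holes
  are equal letters.  Positions are 1-based, whereas list indexing is 0-based.
\<close>

type_synonym word = "enat list"

abbreviation hole :: enat where
  "hole \<equiv> \<infinity>"

definition letter :: "word \<Rightarrow> nat \<Rightarrow> enat" where
  "letter \<pi> i = \<pi> ! (i - 1)"

definition partial_perms :: "nat \<Rightarrow> nat \<Rightarrow> word set" where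
  "partial_perms n k =
     {\<pi>. length \<pi> = n \<and> set \<pi> \<subseteq> insert hole (enat ` {1..n}) \<and>
         count_list \<pi> hole = k \<and> distinct (filter (\<lambda>x. x \<noteq> hole) \<pi>)}"

definition num_letters :: "word \<Rightarrow> nat set" where
  "num_letters \<pi> = {a. enat a \<in> set \<pi>}"

definition missing_letters :: "word \<Rightarrow> nat set" where
  "missing_letters \<pi> = {1..length \<pi>} - num_letters \<pi>"

definition inv_sets :: "nat set \<Rightarrow> nat set \<Rightarrow> nat" where
  "inv_sets A B = card {(a, b). a \<in> A \<and> b \<in> B \<and> a > b}"

definition inv_box :: "nat \<Rightarrow> word \<Rightarrow> nat" where
  "inv_box i \<pi> = card {j. 1 \<le> j \<and> j < i \<and> letter \<pi> j > letter \<pi> i}"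

definition inv0 :: "word \<Rightarrow> nat" where
  "inv0 \<pi> = (\<Sum>i=1..length \<pi>. inv_box i \<pi>)"

definition Des :: "word \<Rightarrow> nat set" where
  "Des \<pi> = {i. 1 \<le> i \<and> i < length \<pi> \<and> letter \<pi> i > letter \<pi> (i + 1)}"

definition des :: "word \<Rightarrow> nat" where
  "des \<pi> = card (Des \<pi>)"

definition maj0 :: "word \<Rightarrow> nat" where
  "maj0 \<pi> = \<Sum>(Des \<pi>)"

definition inv_stat :: "word \<Rightarrow> nat" where
  "inv_stat \<pi> = inv0 \<pi> + inv_sets (num_letters \<pi>) (missing_letters \<pi>)"

definition maj_stat :: "word \<Rightarrow> nat" where
  "maj_stat \<pi> = maj0 \<pi> + inv_sets (num_letters \<pi>) (missing_letters \<pi>)"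

text \<open>
  The identity involves negative powers of \<open>q\<close> and is stated in the fraction field of
  \<open>\<int>[q][z]\<close>: \<open>q\<close> is the variable of the inner, \<open>z\<close> that of the outer polynomial ring.
\<close>

type_synonym ratfun = "int poly poly fract"

definition q_var :: ratfun where
  "q_var = Fract [:[:0, 1:]:] 1"

definition z_var :: ratfun where
  "z_var = Fract [:0, 1:] 1"

lemma finite_partial_perms: "finite (partial_perms n k)"
proof (rule finite_subset)
  show "partial_perms n k \<subseteq> {\<pi>. set \<pi> \<subseteq> insert hole (enat ` {1..n}) \<and> length \<pi> = n}"
    by (auto simp: partial_perms_def)
qed (rule finite_lists_length_eq, simp)

lemma finite_Des: "finite (Des \<pi>)"
  by (rule finite_subset[of _ "{..<length \<pi>}"]) (auto simp: Des_def)

end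

theory Submission
  imports Defs "HOL-Combinatorics.Multiset_Permutations"
begin

text \<open>
  The identity already holds for the words with a prescribed set of \<open>m\<close> numbers and \<open>k\<close> holes.
  Expanding the product over the descents turns such a word into an ordered partition of its letters
  into strictly decreasing blocks; give a partition into \<open>b\<close> blocks the extra weight \<open>\<phi> b\<close>, for an
  arbitrary sequence \<open>\<phi>\<close>.  On the inversion side, inserting one new maximal letter acts on \<open>\<phi>\<close> as
  \<open>D = single_op\<close>, \<open>(D \<phi>) b = [b+1] \<phi> (b+1) + z [b] \<phi> b\<close>, and inserting \<open>k\<close> equal maximal letters as an operator
  \<open>E\<^sub>k\<close> that commutes with \<open>D\<close> and satisfies \<open>(E\<^sub>k \<phi>) 0 = \<phi> k\<close>; the sum is therefore
  \<open>(D\<^sup>m E\<^sub>k \<phi>) 0 = (D\<^sup>m \<phi>) k\<close>.  On the major index side one starts from the word of \<open>k\<close> holes and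
  inserts minimal letters, and each insertion again acts as \<open>D\<close>, which gives \<open>(D\<^sup>m \<phi>) k\<close> directly.
  The theorem is the case \<open>\<phi> = 1\<close>.
\<close>

section \<open>Inserting copies of one letter into words\<close>

text \<open>Described through deletion, so that a word obtained by inserting equal letters in
  several ways is counted once.\<close>

definition insertions :: "'b \<Rightarrow> nat \<Rightarrow> 'b list \<Rightarrow> 'b list set" where
  "insertions M k r = {v. filter (\<lambda>a. a \<noteq> M) v = r \<and> count_list v M = k}"

lemma insertions_Nil: "insertions M k [] = {replicate k M}"
proof -
  have "v = replicate k M" if "v \<in> insertions M k []" for v
    using that by (induction v arbitrary: k) (auto simp: insertions_def split: if_splits)
  moreover have "replicate k M \<in> insertions M k []" by (induction k) (auto simp: insertions_def)
  ultimately show ?thesis by blast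
qed

lemma insertions_0: "M \<notin> set r \<Longrightarrow> insertions M 0 r = {r}"
  by (auto simp: insertions_def count_list_0_iff filter_id_conv intro!: filter_True[symmetric])

lemma insertions_Suc_Cons:
  assumes "x \<noteq> M"
  shows "insertions M (Suc k) (x # r) = (#) M ` insertions M k (x # r) \<union> (#) x ` insertions M (Suc k) r"
proof (intro equalityI subsetI)
  fix v assume "v \<in> insertions M (Suc k) (x # r)"
  then show "v \<in> (#) M ` insertions M k (x # r) \<union> (#) x ` insertions M (Suc k) r"
    by (cases v) (auto simp: insertions_def split: if_splits)
qed (use assms in \<open>auto simp: insertions_def\<close>)

lemma length_insertions: "v \<in> insertions M k r \<Longrightarrow> length v = k + length r"
  by (induction v arbitrary: k r) (fastforce simp: insertions_def split: if_splits)+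

lemma finite_insertions: "finite (insertions M k r)"
proof (rule finite_subset)
  have "set v \<subseteq> insert M (set r)" if "v \<in> insertions M k r" for v
    using that by (auto simp: insertions_def)
  then show "insertions M k r \<subseteq> {v. set v \<subseteq> insert M (set r) \<and> length v = k + length r}"
    by (auto simp: length_insertions)
qed (simp add: finite_lists_length_eq)

lemma sum_insertions_Cons:
  assumes "x \<noteq> M"
  shows "(\<Sum>v\<in>insertions M (Suc k) (x # r). h v)
    = (\<Sum>v\<in>insertions M k (x # r). h (M # v)) + (\<Sum>v\<in>insertions M (Suc k) r. h (x # v))"
proof -
  have "(\<Sum>v\<in>insertions M (Suc k) (x # r). h v)
      = sum h ((#) M ` insertions M k (x # r)) + sum h ((#) x ` insertions M (Suc k) r)"
    unfolding insertions_Suc_Cons[OF assms]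
    using assms by (intro sum.union_disjoint) (auto simp: finite_insertions)
  then show ?thesis by (simp add: sum.reindex)
qed

lemma permutations_insertions:
  assumes "M \<notin># X" "mset w = X"
  shows "{v \<in> permutations_of_multiset (X + replicate_mset k M). filter (\<lambda>a. a \<noteq> M) v = w} = insertions M k w"
proof -
  have "mset v = X + replicate_mset k M \<longleftrightarrow> count_list v M = k" if "filter (\<lambda>a. a \<noteq> M) v = w" for v
  proof -
    have "mset v = filter_mset (\<lambda>a. a \<noteq> M) (mset v) + replicate_mset (count (mset v) M) M"
      by (intro multiset_eqI) auto
    also have "filter_mset (\<lambda>a. a \<noteq> M) (mset v) = X"
      using that assms by auto
    finally show ?thesis by (metis add_left_cancel count_mset count_replicate_mset)
  qed
  then show ?thesis by (auto simp: permutations_of_multiset_def insertions_def)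
qed

text \<open>Deleting all copies of \<open>M\<close> sends an arrangement to an arrangement of
  \<open>X\<close>, and the fibre over \<open>w\<close> is \<open>insertions M k w\<close>.\<close>

lemma sum_permutations_insertions:
  assumes "M \<notin># X"
  shows "sum h (permutations_of_multiset (X + replicate_mset k M))
    = (\<Sum>w\<in>permutations_of_multiset X. sum h (insertions M k w))"
proof -
  let ?f = "filter (\<lambda>a. a \<noteq> M)"
  have "?f ` permutations_of_multiset (X + replicate_mset k M) \<subseteq> permutations_of_multiset X"
  proof
    fix w assume "w \<in> ?f ` permutations_of_multiset (X + replicate_mset k M)"
    then obtain v where v: "mset v = X + replicate_mset k M" "w = ?f v"
      by (auto simp: permutations_of_multiset_def)
    have "filter_mset (\<lambda>a. a \<noteq> M) (X + replicate_mset k M) = X"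
      using assms by (intro multiset_eqI) (auto simp: not_in_iff)
    then show "w \<in> permutations_of_multiset X"
      using v by (simp add: permutations_of_multiset_def)
  qed
  from sum.group[OF _ _ this, of h]
  have "sum h (permutations_of_multiset (X + replicate_mset k M))
    = (\<Sum>w\<in>permutations_of_multiset X.
        sum h {v \<in> permutations_of_multiset (X + replicate_mset k M). ?f v = w})" by simp
  also have "\<dots> = (\<Sum>w\<in>permutations_of_multiset X. sum h (insertions M k w))"
    using assms by (intro sum.cong refl) (simp_all add: permutations_insertions permutations_of_multisetD)
  finally show ?thesis .
qed

text \<open>The variable \<open>z\<close> of the theorem is \<open>q * y\<close>.\<close>

locale q_weights =
  fixes q y :: "'a :: field"
  assumes q_nonzero: "q \<noteq> 0"
begin

section \<open>q-integers and the insertion operators\<close>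

text \<open>The q-integer \<open>1 + q + ... + q^(n-1)\<close>.\<close>

primrec qnum :: "nat \<Rightarrow> 'a" where
  "qnum 0 = 0"
| "qnum (Suc n) = 1 + q * qnum n"

lemma qnum_Suc': "qnum (Suc n) = qnum n + q ^ n"
  by (induction n) (simp_all add: algebra_simps)

text \<open>Only the last letter of a block keeps its inversion factor, so a new maximal letter
  costs one \<open>q\<close> for every block end to its right. Alone in one of the
  \<open>b + 1\<close> gaps it yields \<open>qnum (b + 1)\<close>; at the front of one of the
  \<open>b\<close> blocks it yields \<open>y * (q + ... + q^b)\<close>.\<close>

definition single_op :: "(nat \<Rightarrow> 'a) \<Rightarrow> nat \<Rightarrow> 'a" where
  "single_op \<phi> b = qnum (b + 1) * \<phi> (b + 1) + q * y * qnum b * \<phi> b"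

text \<open>
  The first argument is shifted by one: \<open>max_op (Suc k)\<close> describes the insertion of \<open>k\<close> letters, and
  \<open>max_op 0 = 0\<close> stands for the insertion of \<open>- 1\<close> letters.
\<close>

function max_op :: "nat \<Rightarrow> (nat \<Rightarrow> 'a) \<Rightarrow> nat \<Rightarrow> 'a" where
  "max_op 0 \<phi> b = 0"
| "max_op (Suc k) \<phi> 0 = \<phi> k"
| "max_op (Suc k) \<phi> (Suc b) = max_op k (\<phi> \<circ> Suc) (Suc b)
     + q ^ k * (max_op (Suc k) (\<phi> \<circ> Suc) b + y * max_op k (\<phi> \<circ> Suc) b)"
  by pat_completeness auto
termination by (relation "measure (\<lambda>(k, \<phi>, b). k + b)") auto

lemma max_op_linear: "max_op k (\<lambda>b. \<phi> b + c * \<psi> b) b = max_op k \<phi> b + c * max_op k \<psi> b"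
proof (induction k \<phi> b arbitrary: \<psi> rule: max_op.induct)
  case (3 k \<phi> b)
  have "(\<lambda>b. \<phi> b + c * \<psi> b) \<circ> Suc = (\<lambda>b. (\<phi> \<circ> Suc) b + c * (\<psi> \<circ> Suc) b)" by auto
  then show ?case using 3 by (simp add: algebra_simps o_def)
qed auto

lemma max_op_0: "max_op (Suc 0) \<phi> b = \<phi> b"
  by (induction b arbitrary: \<phi>) auto

text \<open>The right side is \<open>single_op \<phi> k\<close>: this is the commutation of the two
  operators at \<open>b = 0\<close>.\<close>

lemma max_op_at_1: "max_op (Suc k) \<phi> 1 = qnum (k + 1) * \<phi> (k + 1) + q * y * qnum k * \<phi> k"
proof (induction k arbitrary: \<phi>)
  case (Suc k)
  have "max_op (Suc (Suc k)) \<phi> 1 = max_op (Suc k) (\<phi> \<circ> Suc) 1 + q ^ Suc k * (\<phi> (k+2) + y * \<phi> (k+1))"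
    by simp
  then show ?case unfolding Suc qnum_Suc'[of "Suc k"]
    by (simp add: algebra_simps qnum_Suc' del: qnum.simps(2))
qed simp

lemma max_op_single: "max_op (Suc (Suc 0)) \<phi> b = single_op \<phi> b"
  by (induction b arbitrary: \<phi>) (simp_all add: single_op_def max_op_0 algebra_simps)

text \<open>The defining recursion of \<open>max_op\<close> looks at the end of the word, this one
  at its beginning: the first old block is untouched, or preceded by an inserted block, or joined to
  an inserted letter. In the last two cases an inserted letter precedes all \<open>b + 1\<close> old
  block ends, whence \<open>q ^ Suc b\<close>.\<close>

lemma max_op_Suc_Suc:
  "max_op (Suc k) \<phi> (Suc b) = max_op (Suc k) (\<phi> \<circ> Suc) b
     + q ^ Suc b * (max_op k (\<phi> \<circ> Suc) (Suc b) + y * max_op k (\<phi> \<circ> Suc) b)"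
proof (induction b arbitrary: k \<phi>)
  case 0
  show ?case
  proof (cases k)
    case (Suc k')
    show ?thesis using max_op_at_1[of k \<phi>] max_op_at_1[of k' "\<phi> \<circ> Suc"]
      by (simp add: Suc algebra_simps o_def del: max_op.simps(3))
  qed simp
next
  case (Suc b)
  note IH = Suc
  show ?case
  proof (induction k arbitrary: \<phi>)
    case 0
    then show ?case by (simp add: max_op_0)
  next
    case (Suc k)
    have "max_op (Suc (Suc k)) \<phi> (Suc (Suc b)) = max_op (Suc k) (\<phi> \<circ> Suc) (Suc (Suc b))
       + q ^ Suc k * (max_op (Suc (Suc k)) (\<phi> \<circ> Suc) (Suc b) + y * max_op (Suc k) (\<phi> \<circ> Suc) (Suc b))"
      by (rule max_op.simps(3))
    also have "max_op (Suc k) (\<phi> \<circ> Suc) (Suc (Suc b)) = max_op (Suc k) (\<phi> \<circ> Suc \<circ> Suc) (Suc b)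
       + q ^ Suc (Suc b) * (max_op k (\<phi> \<circ> Suc \<circ> Suc) (Suc (Suc b)) + y * max_op k (\<phi> \<circ> Suc \<circ> Suc) (Suc b))"
      by (rule Suc)
    also note IH[of "Suc k" "\<phi> \<circ> Suc"]
    also note IH[of "k" "\<phi> \<circ> Suc"]
    finally show ?case
      unfolding max_op.simps(3)[of "Suc k" "\<phi> \<circ> Suc" b] max_op.simps(3)[of "k" "\<phi> \<circ> Suc" b]
        max_op.simps(3)[of "k" "\<phi> \<circ> Suc" "Suc b"]
      by (simp add: algebra_simps o_def del: max_op.simps(3))
  qed
qed

lemma single_op_Suc: "single_op \<phi> (Suc b) = q * single_op (\<phi> \<circ> Suc) b + (\<phi> (b + 2) + q * y * \<phi> (Suc b))"
  by (simp add: single_op_def algebra_simps)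

lemma max_op_commute: "max_op k (single_op \<phi>) = single_op (max_op k \<phi>)"
proof
  show "max_op k (single_op \<phi>) b = single_op (max_op k \<phi>) b" for b
  proof (induction k \<phi> b rule: max_op.induct)
    case (1 \<phi> b)
    then show ?case by (simp add: single_op_def)
  next
    case (2 k \<phi>)
    then show ?case using max_op_at_1[of k \<phi>] by (simp add: single_op_def algebra_simps del: max_op.simps(3))
  next
    case (3 k \<phi> b)
    let ?s = "\<phi> \<circ> Suc" and ?d = "single_op (\<phi> \<circ> Suc)"
    have SD: "single_op \<phi> \<circ> Suc = (\<lambda>b. ((\<phi> \<circ> Suc \<circ> Suc) b + (q * y) * (\<phi> \<circ> Suc) b) + q * single_op (\<phi> \<circ> Suc) b)"
      by (auto simp: single_op_Suc fun_eq_iff)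
    have "max_op (Suc k) (single_op \<phi>) (Suc b) = q * (max_op k ?d (Suc b) + q ^ k * (max_op (Suc k) ?d b + y * max_op k ?d b))
        + max_op (Suc k) ?s (Suc b) + q * y * max_op (Suc k) \<phi> (Suc b)"
      unfolding max_op.simps(3) SD max_op_linear by (simp add: algebra_simps o_def del: max_op.simps(3))
    also have "\<dots> = q * (single_op (max_op k ?s) (Suc b) + q ^ k * (single_op (max_op (Suc k) ?s) b + y * single_op (max_op k ?s) b))
        + max_op (Suc k) ?s (Suc b) + q * y * max_op (Suc k) \<phi> (Suc b)"
      unfolding 3 by simp
    also have "\<dots> = q * single_op (max_op (Suc k) \<phi> \<circ> Suc) b + (max_op (Suc k) \<phi> (b + 2) + q * y * max_op (Suc k) \<phi> (Suc b))"
    proof -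
      have "single_op (max_op (Suc k) \<phi> \<circ> Suc) b =
         single_op (max_op k ?s \<circ> Suc) b + q ^ k * (single_op (max_op (Suc k) ?s) b + y * single_op (max_op k ?s) b)"
        by (simp add: single_op_def algebra_simps)
      \<comment> \<open>Expanded at the beginning of the word, not at the end: the correction with
        \<open>q ^ (b + 2)\<close> is then \<open>q\<close> times the correction in the next fact,
        and the two cancel.\<close>
      moreover have "max_op (Suc k) \<phi> (b + 2) = max_op (Suc k) ?s (Suc b)
         + q ^ (b + 2) * (max_op k ?s (b + 2) + y * max_op k ?s (Suc b))"
        using max_op_Suc_Suc[of k \<phi> "Suc b"] by simp
      moreover have "single_op (max_op k ?s) (Suc b) = single_op (max_op k ?s \<circ> Suc) b
          + q ^ Suc b * (max_op k ?s (b + 2) + y * max_op k ?s (Suc b))"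
        unfolding single_op_def qnum_Suc' by (simp add: qnum_Suc' algebra_simps del: max_op.simps(3) qnum.simps(2))
      ultimately show ?thesis by (simp add: algebra_simps del: max_op.simps(3))
    qed
    also have "\<dots> = single_op (max_op (Suc k) \<phi>) (Suc b)" by (simp add: single_op_Suc del: max_op.simps(3))
    finally show ?case .
  qed
qed

lemma max_op_funpow: "max_op k ((single_op ^^ m) \<phi>) = (single_op ^^ m) (max_op k \<phi>)"
  by (induction m) (simp_all add: max_op_commute)

section \<open>Inversion side: inserting maximal letters\<close>

text \<open>
  Words are read backwards, so that \<open>x # r\<close> is the word ending in \<open>x\<close>.  The weight
  \<open>inv_weight_last\<close> of \<open>x # r\<close> omits the factor contributed by the inversions of its last letter \<open>x\<close>;
  the summand with \<open>y\<close> joins \<open>x\<close> to the block of the preceding letter \<open>a\<close>.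
\<close>

fun inv_weight :: "(nat \<Rightarrow> 'a) \<Rightarrow> 'b::linorder list \<Rightarrow> 'a"
  and inv_weight_last :: "(nat \<Rightarrow> 'a) \<Rightarrow> 'b \<Rightarrow> 'b list \<Rightarrow> 'a" where
  "inv_weight \<phi> [] = \<phi> 0"
| "inv_weight \<phi> (x # r) = q ^ length (filter (\<lambda>a. a > x) r) * inv_weight_last \<phi> x r"
| "inv_weight_last \<phi> x [] = \<phi> 1"
| "inv_weight_last \<phi> x (a # r) = inv_weight (\<phi> \<circ> Suc) (a # r) + (if a > x then y * inv_weight_last \<phi> a r else 0)"

lemma inv_weight_linear:
  "inv_weight (\<lambda>b. \<phi> b + c * \<psi> b) r = inv_weight \<phi> r + c * inv_weight \<psi> r"
  "inv_weight_last (\<lambda>b. \<phi> b + c * \<psi> b) x r = inv_weight_last \<phi> x r + c * inv_weight_last \<psi> x r"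
proof (induction \<phi> r and \<phi> x r arbitrary: \<psi> and \<psi> rule: inv_weight_inv_weight_last.induct)
  case (4 \<phi> x a r)
  then show ?case by (simp add: algebra_simps o_def)
qed (simp_all add: algebra_simps)

text \<open>A nonempty word has at least one block, so the value at 0 is never reached.\<close>

lemma inv_weight_last_cong: "(\<And>b. \<phi> (Suc b) = \<psi> (Suc b)) \<Longrightarrow> inv_weight_last \<phi> x r = inv_weight_last \<psi> x r"
  by (induction r arbitrary: x) (simp_all add: o_def)

text \<open>Only the values at \<open>b > 0\<close>, where \<open>b - 1\<close> does not truncate, matter.\<close>

definition max_op_last :: "nat \<Rightarrow> (nat \<Rightarrow> 'a) \<Rightarrow> nat \<Rightarrow> 'a" where
  "max_op_last k \<phi> b = max_op (Suc k) (\<phi> \<circ> Suc) (b - 1) + y * max_op k (\<phi> \<circ> Suc) (b - 1)"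

lemma inv_weight_replicate: "inv_weight \<phi> (replicate k M) = \<phi> k"
  and inv_weight_last_replicate: "inv_weight_last \<phi> M (replicate k M) = \<phi> (Suc k)"
proof -
  have "(\<forall>\<phi>. inv_weight \<phi> (replicate k M) = \<phi> k) \<and> (\<forall>\<phi>. inv_weight_last \<phi> M (replicate k M) = \<phi> (Suc k))"
    by (induction k) (auto simp: filter_empty_conv)
  then show "inv_weight \<phi> (replicate k M) = \<phi> k" "inv_weight_last \<phi> M (replicate k M) = \<phi> (Suc k)" by blast+
qed

text \<open>No letter exceeds \<open>M\<close>, so \<open>M\<close> cannot be joined to the letter
  before it.\<close>

lemma inv_weight_last_max:
  assumes "\<And>a. a \<in> set r \<Longrightarrow> a \<le> M"
  shows "inv_weight_last \<phi> M r = inv_weight (\<phi> \<circ> Suc) r"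
  using assms by (cases r) (force)+

lemma inv_weight_Cons_max:
  assumes "\<And>a. a \<in> set r \<Longrightarrow> a \<le> M"
  shows "inv_weight \<phi> (M # r) = inv_weight (\<phi> \<circ> Suc) r"
proof -
  have "filter (\<lambda>a. a > M) r = []" using assms by (force simp: filter_empty_conv)
  then show ?thesis using inv_weight_last_max[OF assms] by simp
qed

text \<open>Proved by induction on \<open>r\<close> together with a version in which a last letter
  \<open>x < M\<close> stays last. There \<open>max_op_last k\<close> either places all copies of
  \<open>M\<close> among the \<open>b - 1\<close> earlier blocks, or joins one to the last block
  (factor \<open>y\<close>) and places \<open>k - 1\<close> among the earlier ones.\<close>

lemma sum_insertions:
  fixes M :: "'b::linorder"
  assumes "\<And>a. a \<in> set r \<Longrightarrow> a < M"
  shows "(\<Sum>v\<in>insertions M k r. inv_weight \<phi> v) = inv_weight (max_op (Suc k) \<phi>) r"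
proof -
  have less_M: "a < M" if "v \<in> insertions M k r" "a \<in> set v" "a \<noteq> M" "\<And>a. a \<in> set r \<Longrightarrow> a < M" for v a k r
    using that by (auto simp: insertions_def)
  have le_M: "a \<le> M" if "v \<in> insertions M k r" "a \<in> set v" "\<And>a. a \<in> set r \<Longrightarrow> a < M" for v a k r
    using that less_M[OF that(1,2)] by force
  have "(\<forall>k \<phi>. (\<Sum>v\<in>insertions M k r. inv_weight \<phi> v) = inv_weight (max_op (Suc k) \<phi>) r) \<and>
     (\<forall>k \<phi> x. x < M \<longrightarrow> (\<Sum>v\<in>insertions M k r. inv_weight_last \<phi> x v) = inv_weight_last (max_op_last k \<phi>) x r)"
    using assms
  proof (induction r)
    case Nil
    have "inv_weight_last \<phi> x (replicate k M) = inv_weight_last (max_op_last k \<phi>) x []" if "x < M" for \<phi> k x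
      using that by (cases k) (simp_all add: max_op_last_def inv_weight_last_replicate inv_weight_replicate)
    then show ?case by (simp add: insertions_Nil inv_weight_replicate)
  next
    case (Cons x r)
    have x: "x < M" and r: "\<And>a. a \<in> set r \<Longrightarrow> a < M" using Cons.prems by auto
    have IHp: "(\<Sum>v\<in>insertions M k r. inv_weight_last \<phi> x v) = inv_weight_last (max_op_last k \<phi>) x r" for k \<phi> using Cons.IH x r by blast
    \<comment> \<open>Every inserted letter exceeds \<open>x\<close> and precedes it in the word, so
      it adds one inversion at \<open>x\<close>.\<close>
    have len: "length (filter (\<lambda>a. a > x) v) = k + length (filter (\<lambda>a. a > x) r)"
      if "v \<in> insertions M k r" for v k
      using that x
      by (induction v arbitrary: k r) (auto simp: insertions_def split: if_splits)
    have x_part: "(\<Sum>v\<in>insertions M k r. inv_weight \<phi> (x # v)) = q ^ k * inv_weight (max_op_last k \<phi>) (x # r)" for k \<phi>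
      by (simp add: len power_add mult.assoc IHp[symmetric] sum_distrib_left)
    have F: "(\<Sum>v\<in>insertions M k (x # r). inv_weight \<phi> v) = inv_weight (max_op (Suc k) \<phi>) (x # r)" for k \<phi>
    proof (induction k arbitrary: \<phi>)
      case 0
      show ?case using Cons.prems by (subst insertions_0) (auto simp: max_op_0[abs_def])
    next
      case (Suc k)
      have "(\<Sum>v\<in>insertions M (Suc k) (x # r). inv_weight \<phi> v)
          = (\<Sum>v\<in>insertions M k (x # r). inv_weight \<phi> (M # v)) + (\<Sum>v\<in>insertions M (Suc k) r. inv_weight \<phi> (x # v))"
        using x by (intro sum_insertions_Cons) auto
      also have "(\<Sum>v\<in>insertions M k (x # r). inv_weight \<phi> (M # v)) = (\<Sum>v\<in>insertions M k (x # r). inv_weight (\<phi> \<circ> Suc) v)"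
        using Cons.prems by (intro sum.cong refl inv_weight_Cons_max) (auto dest: le_M)
      also have "\<dots> + (\<Sum>v\<in>insertions M (Suc k) r. inv_weight \<phi> (x # v))
          = inv_weight (\<lambda>b. max_op (Suc k) (\<phi> \<circ> Suc) b + q ^ Suc k * max_op_last (Suc k) \<phi> b) (x # r)"
        unfolding Suc x_part inv_weight_linear by simp
      \<comment> \<open>This is the recursion of \<open>max_op\<close>, available only for
        \<open>b > 0\<close>; that suffices, as \<open>x # r\<close> is nonempty.\<close>
      also have "\<dots> = inv_weight (max_op (Suc (Suc k)) \<phi>) (x # r)"
        unfolding inv_weight.simps by (intro arg_cong2[of _ _ _ _ "(*)"] refl inv_weight_last_cong) (simp add: max_op_last_def)
      finally show ?case .
    qed
    have "(\<Sum>v\<in>insertions M k (x # r). inv_weight_last \<phi> x' v) = inv_weight_last (max_op_last k \<phi>) x' (x # r)" if "x' < M" for k \<phi> x'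
    proof (cases k)
      case 0
      have "inv_weight_last \<phi> x' (x # r) = inv_weight_last (max_op_last 0 \<phi>) x' (x # r)"
        by (rule inv_weight_last_cong) (simp add: max_op_last_def max_op_0)
      then show ?thesis using Cons.prems 0 by (subst 0, subst insertions_0) auto
    next
      case (Suc j)
      \<comment> \<open>Three cases for the last letter \<open>x'\<close>: it is a block of its own,
        or joined to a preceding \<open>M\<close>, or joined to a preceding
        \<open>x\<close>.\<close>
      have "(\<Sum>v\<in>insertions M k (x # r). inv_weight_last \<phi> x' v)
          = (\<Sum>v\<in>insertions M k (x # r). inv_weight (\<phi> \<circ> Suc) v) 
            + y * (\<Sum>v\<in>insertions M j (x # r). inv_weight (\<phi> \<circ> Suc) v)
            + (if x' < x then y * (\<Sum>v\<in>insertions M k r. inv_weight_last \<phi> x v) else 0)"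
      proof -
        have *: "(\<Sum>v\<in>insertions M j (x # r). inv_weight_last \<phi> M v) = (\<Sum>v\<in>insertions M j (x # r). inv_weight (\<phi> \<circ> Suc) v)"
          using Cons.prems by (intro sum.cong refl inv_weight_last_max) (auto dest: le_M)
        have sp: "(\<Sum>v\<in>insertions M k (x # r). h v)
          = (\<Sum>v\<in>insertions M j (x # r). h (M # v)) + (\<Sum>v\<in>insertions M k r. h (x # v))" for h :: "'b list \<Rightarrow> 'a"
          unfolding Suc using x by (intro sum_insertions_Cons) auto
        show ?thesis unfolding sp using that
          by (simp add: sum.distrib algebra_simps sum_distrib_left[symmetric] * del: inv_weight.simps)
      qed
      also have "\<dots> = inv_weight (\<lambda>b. max_op (Suc k) (\<phi> \<circ> Suc) b + y * max_op k (\<phi> \<circ> Suc) b) (x # r)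
          + (if x' < x then y * inv_weight_last (max_op_last k \<phi>) x r else 0)"
        unfolding F IHp inv_weight_linear Suc ..
      also have "\<dots> = inv_weight_last (max_op_last k \<phi>) x' (x # r)"
        by (simp add: max_op_last_def[abs_def] o_def)
      finally show ?thesis .
    qed
    with F show ?case by blast
  qed
  then show "(\<Sum>v\<in>insertions M k r. inv_weight \<phi> v) = inv_weight (max_op (Suc k) \<phi>) r" by blast
qed

section \<open>Major index side: inserting minimal letters\<close>

text \<open>Again on reversed words, with an arbitrary weight \<open>\<psi>\<close> of the number of descents.\<close>

fun maj_weight :: "(nat \<Rightarrow> 'a) \<Rightarrow> 'b::linorder list \<Rightarrow> 'a" where
  "maj_weight \<psi> [] = \<psi> 0"
| "maj_weight \<psi> [a] = \<psi> 0"
| "maj_weight \<psi> (a # b # r) = (if b > a then q ^ Suc (length r) * maj_weight (\<psi> \<circ> Suc) (b # r) else maj_weight \<psi> (b # r))"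

lemma maj_weight_linear: "maj_weight (\<lambda>d. c * \<psi> d + c' * \<psi>' d) r = c * maj_weight \<psi> r + c' * maj_weight \<psi>' r"
  by (induction \<psi> r arbitrary: \<psi>' rule: maj_weight.induct) (simp_all add: o_def distrib_left mult.left_commute)

lemma maj_weight_cong: 
  "(\<And>d. d \<le> length r - 1 \<Longrightarrow> \<psi> d = \<psi>' d) \<Longrightarrow> maj_weight \<psi> r = maj_weight \<psi>' r"
  by (induction \<psi> r arbitrary: \<psi>' rule: maj_weight.induct) (auto simp: o_def)

lemma maj_weight_replicate: "maj_weight \<psi> (replicate k M) = \<psi> 0"
proof (induction k)
  case (Suc k)
  then show ?case by (cases k) auto
qed simp

text \<open>The classical insertion argument: of the \<open>length r + 1\<close> positions before
  the last letter of a word with \<open>d\<close> descents, \<open>d + 1\<close> create no descent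
  and raise the major index by 0, ..., d; the others create one and raise it by d + 1, ...,
  \<open>length r\<close>.\<close>

lemma sum_insertions_min_Cons:
  fixes x :: "'b::linorder"
  assumes "\<And>a. a \<in> set (b # r) \<Longrightarrow> x < a"
  shows "(\<Sum>v\<in>insertions x 1 r. maj_weight \<psi> (b # v))
    = maj_weight (\<lambda>d. qnum (d + 1) * \<psi> d + q ^ (d + 1) * qnum (length r - d) * \<psi> (d + 1)) (b # r)"
  using assms
proof (induction r arbitrary: b \<psi>)
  case Nil
  then show ?case by (auto simp: insertions_Nil)
next
  case (Cons c r)
  let ?N = "length (c # r)"
  define \<chi> where "\<chi> \<psi> d = qnum (d + 1) * \<psi> d + q ^ (d + 1) * qnum (length r - d) * \<psi> (d + 1)" for \<psi> d
  have x: "x < b" "x < c" "x \<notin> set r" using Cons.prems by auto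
  have IH: "(\<Sum>v\<in>insertions x 1 r. maj_weight \<psi> (c # v)) = maj_weight (\<chi> \<psi>) (c # r)" for \<psi>
    unfolding \<chi>_def using Cons by auto
  have "(\<Sum>v\<in>insertions x 1 (c # r). maj_weight \<psi> (b # v))
      = (\<Sum>v\<in>insertions x 0 (c # r). maj_weight \<psi> (b # x # v)) + (\<Sum>v\<in>insertions x 1 r. maj_weight \<psi> (b # c # v))"
    unfolding One_nat_def using x by (intro sum_insertions_Cons) auto
  \<comment> \<open>Directly before \<open>b\<close>, the letter \<open>x\<close> makes a descent at
    position \<open>?N\<close> and an ascent after it.\<close>
  also have "(\<Sum>v\<in>insertions x 0 (c # r). maj_weight \<psi> (b # x # v)) = q ^ ?N * maj_weight (\<psi> \<circ> Suc) (c # r)"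
    using x by (subst insertions_0) (auto simp: o_def)
  \<comment> \<open>Elsewhere the insertion shifts \<open>c\<close> to position
    \<open>?N + 1\<close>, together with a possible descent from \<open>c\<close> to
    \<open>b\<close>.\<close>
  also have "(\<Sum>v\<in>insertions x 1 r. maj_weight \<psi> (b # c # v))
      = (if c > b then q ^ Suc ?N * maj_weight (\<chi> (\<psi> \<circ> Suc)) (c # r) else maj_weight (\<chi> \<psi>) (c # r))"
    using length_insertions[of _ x 1 r]
    by (auto simp flip: IH simp: sum_distrib_left intro!: sum.cong)
  also have "q ^ ?N * maj_weight (\<psi> \<circ> Suc) (c # r) + \<dots>
      = (if c > b then q ^ ?N * maj_weight (\<lambda>d. 1 * (\<psi> \<circ> Suc) d + q * \<chi> (\<psi> \<circ> Suc) d) (c # r)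
         else maj_weight (\<lambda>d. q ^ ?N * (\<psi> \<circ> Suc) d + 1 * \<chi> \<psi> d) (c # r))"
    unfolding maj_weight_linear by (simp add: algebra_simps o_def)
  also have "\<dots> = maj_weight (\<lambda>d. qnum (d + 1) * \<psi> d + q ^ (d + 1) * qnum (length (c # r) - d) * \<psi> (d + 1)) (b # c # r)"
  proof -
    have "maj_weight (\<lambda>d. 1 * (\<psi> \<circ> Suc) d + q * \<chi> (\<psi> \<circ> Suc) d) (c # r) =
       maj_weight ((\<lambda>d. qnum (d + 1) * \<psi> d + q ^ (d + 1) * qnum (length (c # r) - d) * \<psi> (d + 1)) \<circ> Suc) (c # r)"
      by (rule maj_weight_cong) (simp add: \<chi>_def algebra_simps)
    moreover have "maj_weight (\<lambda>d. q ^ ?N * (\<psi> \<circ> Suc) d + 1 * \<chi> \<psi> d) (c # r) =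
      maj_weight (\<lambda>d. qnum (d + 1) * \<psi> d + q ^ (d + 1) * qnum (length (c # r) - d) * \<psi> (d + 1)) (c # r)"
    proof (rule maj_weight_cong)
      fix d assume "d \<le> length (c # r) - 1"
      \<comment> \<open>The increment \<open>?N\<close> is the new top of the range; the bound on
        \<open>d\<close> prevents truncation in \<open>length r - d\<close>.\<close>
      then have "qnum (length (c # r) - d) = qnum (length r - d) + q ^ (length r - d)"
        and "q ^ ?N = q ^ (d + 1) * q ^ (length r - d)"
        using qnum_Suc'[of "length r - d"] by (simp_all add: Suc_diff_le flip: power_add)
      then show "q ^ ?N * (\<psi> \<circ> Suc) d + 1 * \<chi> \<psi> d
        = qnum (d + 1) * \<psi> d + q ^ (d + 1) * qnum (length (c # r) - d) * \<psi> (d + 1)"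
        using q_nonzero by (simp add: \<chi>_def algebra_simps del: qnum.simps(2))
    qed
    ultimately show ?thesis by simp
  qed
  finally show ?case .
qed

text \<open>For nonempty \<open>r\<close> one position remains, after the last letter:
  \<open>x\<close> creates a descent at \<open>length r\<close> there, which is the increment still
  missing.\<close>

lemma sum_insertions_min:
  fixes x :: "'b::linorder"
  assumes "\<And>a. a \<in> set r \<Longrightarrow> x < a"
  shows "(\<Sum>v\<in>insertions x 1 r. maj_weight \<psi> v)
    = maj_weight (\<lambda>d. qnum (d + 1) * \<psi> d + q ^ (d + 1) * qnum (length r - d) * \<psi> (d + 1)) r"
proof (cases r)
  case (Cons b r')
  let ?\<chi> = "\<lambda>d. qnum (d + 1) * \<psi> d + q ^ (d + 1) * qnum (length r' - d) * \<psi> (d + 1)"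
  have x: "x < b" "x \<notin> set r'" using assms Cons by auto
  have "(\<Sum>v\<in>insertions x 1 r. maj_weight \<psi> v)
      = (\<Sum>v\<in>insertions x 0 (b # r'). maj_weight \<psi> (x # v)) + (\<Sum>v\<in>insertions x 1 r'. maj_weight \<psi> (b # v))"
    unfolding One_nat_def Cons using x by (intro sum_insertions_Cons) auto
  also have "(\<Sum>v\<in>insertions x 0 (b # r'). maj_weight \<psi> (x # v)) = q ^ length r * maj_weight (\<psi> \<circ> Suc) (b # r')"
    using x by (subst insertions_0) (auto simp: Cons o_def)
  also have "(\<Sum>v\<in>insertions x 1 r'. maj_weight \<psi> (b # v)) = maj_weight ?\<chi> (b # r')"
    using assms by (intro sum_insertions_min_Cons) (simp add: Cons)
  also have "q ^ length r * maj_weight (\<psi> \<circ> Suc) (b # r') + maj_weight ?\<chi> (b # r')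
      = maj_weight (\<lambda>d. q ^ length r * (\<psi> \<circ> Suc) d + 1 * ?\<chi> d) (b # r')"
    unfolding maj_weight_linear by (simp add: o_def)
  also have "\<dots> = maj_weight (\<lambda>d. qnum (d + 1) * \<psi> d + q ^ (d + 1) * qnum (length r - d) * \<psi> (d + 1)) (b # r')"
  proof (rule maj_weight_cong)
    fix d assume "d \<le> length (b # r') - 1"
    then have "qnum (length r - d) = qnum (length r' - d) + q ^ (length r' - d)"
      and "q ^ length r = q ^ (d + 1) * q ^ (length r' - d)"
      using qnum_Suc'[of "length r' - d"] by (simp_all add: Cons Suc_diff_le flip: power_add)
    then show "q ^ length r * (\<psi> \<circ> Suc) d + 1 * ?\<chi> d
      = qnum (d + 1) * \<psi> d + q ^ (d + 1) * qnum (length r - d) * \<psi> (d + 1)"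
      by (simp add: algebra_simps del: qnum.simps(2))
  qed
  finally show ?thesis unfolding Cons .
qed (simp add: insertions_Nil)

text \<open>
  The coefficient of \<open>z\<^sup>j\<close> in \<open>\<Prod>i=1..d. 1 + z / q\<^sup>i\<close> is weighted by \<open>\<phi> (N - j)\<close>; a word of length \<open>N\<close> with
  \<open>j\<close> marked descents has \<open>N - j\<close> blocks.
\<close>

primrec des_weight :: "(nat \<Rightarrow> 'a) \<Rightarrow> nat \<Rightarrow> nat \<Rightarrow> 'a" where
  "des_weight \<phi> N 0 = \<phi> N"
| "des_weight \<phi> N (Suc d) = des_weight \<phi> N d + q * y / q ^ Suc d * des_weight \<phi> (N - 1) d"

lemma des_weight_1: "des_weight (\<lambda>_. 1) N d = (\<Prod>i=1..d. 1 + q * y / q ^ i)"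
proof (induction d arbitrary: N)
  case (Suc d)
  have "des_weight (\<lambda>_. 1) N (Suc d) = (1 + q * y / q ^ Suc d) * (\<Prod>i=1..d. 1 + q * y / q ^ i)"
    unfolding des_weight.simps Suc by (simp add: algebra_simps)
  then show ?case by simp
qed simp

text \<open>Turns the multiplier found for a minimal letter into \<open>single_op\<close> acting on
  \<open>\<phi>\<close>. The induction on \<open>d\<close> needs all \<open>N\<close>, since the
  recursion of \<open>des_weight\<close> lowers \<open>N\<close>.\<close>

lemma des_weight_single_op:
  assumes "d \<le> N"
  shows "qnum (d + 1) * des_weight \<phi> (Suc N) d + q ^ (d + 1) * qnum (N - d) * des_weight \<phi> (Suc N) (d + 1) = des_weight (single_op \<phi>) N d"
  using assms
proof (induction d arbitrary: N)
  case 0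
  then show ?case using q_nonzero by (simp add: single_op_def algebra_simps)
next
  case (Suc d)
  then obtain K where N: "N = Suc K" and dK: "d \<le> K" by (cases N) auto
  have [simp]: "Suc K - d = Suc (K - d)" using dK by simp
  \<comment> \<open>Both sides are \<open>qnum (K + 2)\<close>, cut after \<open>d + 1\<close> and
    after \<open>d + 2\<close> terms.\<close>
  have e: "qnum (d + 1) + q ^ (d + 1) * qnum (Suc (K - d)) = qnum (d + 2) + q ^ (d + 2) * qnum (K - d)"
    using qnum_Suc'[of "Suc d"] by (simp add: algebra_simps)
  have "des_weight (single_op \<phi>) N (Suc d) = des_weight (single_op \<phi>) (Suc K) d + q * y / q ^ Suc d * des_weight (single_op \<phi>) K d"
    by (simp add: N)
  also have "des_weight (single_op \<phi>) (Suc K) d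
      = qnum (d + 1) * des_weight \<phi> (K + 2) d + q ^ (d + 1) * qnum (Suc (K - d)) * des_weight \<phi> (K + 2) (d + 1)"
    using Suc.IH[of "Suc K"] dK by (simp del: des_weight.simps)
  also have "des_weight (single_op \<phi>) K d
      = qnum (d + 1) * des_weight \<phi> (Suc K) d + q ^ (d + 1) * qnum (K - d) * des_weight \<phi> (Suc K) (d + 1)"
    using Suc.IH[of K] dK by simp
  also have "qnum (d + 1) * des_weight \<phi> (K + 2) d + q ^ (d + 1) * qnum (Suc (K - d)) * des_weight \<phi> (K + 2) (d + 1)
     + q * y / q ^ Suc d * (qnum (d + 1) * des_weight \<phi> (Suc K) d + q ^ (d + 1) * qnum (K - d) * des_weight \<phi> (Suc K) (d + 1))
     = (qnum (d + 1) + q ^ (d + 1) * qnum (Suc (K - d))) * des_weight \<phi> (K + 2) (d + 1)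
       + q * y * qnum (K - d) * des_weight \<phi> (Suc K) (d + 1)"
  proof -
    have "des_weight \<phi> (K + 2) (d + 1) = des_weight \<phi> (K + 2) d + q * y / q ^ Suc d * des_weight \<phi> (Suc K) d" by simp
    moreover have "q * y / q ^ Suc d * q ^ (d + 1) = q * y" using q_nonzero by simp
    moreover have "m * a + l * n * b + p * (m * c + l * n' * e) = (m + l * n) * b + t * n' * e"
      if "b = a + p * c" "p * l = t" for m a l n b p c n' e t :: 'a
      unfolding that(1) that(2)[symmetric] by (simp add: algebra_simps)
    ultimately show ?thesis by blast
  qed
  also have "\<dots> = qnum (d + 2) * des_weight \<phi> (K + 2) (d + 1)
     + q ^ (d + 2) * qnum (K - d) * (des_weight \<phi> (K + 2) (d + 1) + q * y / q ^ (d + 2) * des_weight \<phi> (Suc K) (d + 1))"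
  proof -
    have "q ^ (d + 2) * (q * y / q ^ (d + 2)) = q * y" using q_nonzero by simp
    moreover have "(m + l * n) * b + t * n * e = m * b + l * n * (b + p * e)"
      if "l * p = t" for m l n b t e p :: 'a
      unfolding that[symmetric] by (simp add: algebra_simps)
    ultimately show ?thesis unfolding e by blast
  qed
  finally show ?case by (simp add: N)
qed

section \<open>Summing over all arrangements\<close>

text \<open>The elements of \<open>A\<close> are inserted from the largest down, so each is minimal
  when it enters. The start is the word of \<open>k\<close> equal letters, which has no descent and
  weight \<open>\<phi> k\<close>.\<close>

lemma sum_maj_weight_permutations:
  fixes M :: "'b::linorder"
  assumes "finite A" "\<And>a. a \<in> A \<Longrightarrow> a < M"
  shows "(\<Sum>r\<in>permutations_of_multiset (mset_set A + replicate_mset k M). maj_weight (des_weight \<phi> (card A + k)) r)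
    = (single_op ^^ card A) \<phi> k"
  using assms
proof (induction A arbitrary: \<phi> rule: finite_linorder_min_induct)
  case empty
  show ?case using sum_permutations_insertions[of M "{#}" "maj_weight (des_weight \<phi> k)" k]
    by (simp add: insertions_Nil maj_weight_replicate)
next
  case (insert x A)
  let ?X = "mset_set A + replicate_mset k M"
  have xA: "x \<notin> A" and xM: "x < M" and *: "x \<notin># ?X"
    using insert.hyps insert.prems by (auto split: if_splits)
  have "mset_set (insert x A) + replicate_mset k M = ?X + replicate_mset 1 x"
    using insert.hyps xA by simp
  then have "(\<Sum>r\<in>permutations_of_multiset (mset_set (insert x A) + replicate_mset k M). maj_weight (des_weight \<phi> (card (insert x A) + k)) r)
    = (\<Sum>w\<in>permutations_of_multiset ?X. \<Sum>v\<in>insertions x 1 w. maj_weight (des_weight \<phi> (Suc (card A + k))) v)"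
    using sum_permutations_insertions[OF *, of _ 1] insert.hyps xA by simp
  also have "\<dots> = (\<Sum>w\<in>permutations_of_multiset ?X. maj_weight (des_weight (single_op \<phi>) (card A + k)) w)"
  proof (intro sum.cong refl)
    fix w assume "w \<in> permutations_of_multiset ?X"
    then have mset_w: "mset w = ?X" by (simp add: permutations_of_multiset_def)
    then have len: "length w = card A + k" by (metis size_mset size_mset_set size_replicate_mset size_union)
    have "x < a" if "a \<in> set w" for a
      using that insert.hyps xM set_mset_mset[of w] by (auto simp: mset_w split: if_splits)
    then have "(\<Sum>v\<in>insertions x 1 w. maj_weight (des_weight \<phi> (Suc (card A + k))) v)
        = maj_weight (\<lambda>d. qnum (d + 1) * des_weight \<phi> (Suc (card A + k)) d
            + q ^ (d + 1) * qnum (length w - d) * des_weight \<phi> (Suc (card A + k)) (d + 1)) w"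
      by (rule sum_insertions_min)
    also have "\<dots> = maj_weight (des_weight (single_op \<phi>) (card A + k)) w"
    proof (rule maj_weight_cong)
      fix d assume "d \<le> length w - 1"
      then have "d \<le> card A + k" using len by simp
      from des_weight_single_op[OF this] show "qnum (d + 1) * des_weight \<phi> (Suc (card A + k)) d
          + q ^ (d + 1) * qnum (length w - d) * des_weight \<phi> (Suc (card A + k)) (d + 1)
        = des_weight (single_op \<phi>) (card A + k) d"
        by (simp only: len)
    qed
    finally show "(\<Sum>v\<in>insertions x 1 w. maj_weight (des_weight \<phi> (Suc (card A + k))) v) = maj_weight (des_weight (single_op \<phi>) (card A + k)) w" .
  qed
  also have "\<dots> = (single_op ^^ card A) (single_op \<phi>) k" using insert by simp
  finally show ?case using insert.hyps xA by (simp add: funpow_swap1)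
qed

lemma sum_inv_weight_permutations:
  fixes M :: "'b::linorder"
  assumes "finite A" "\<And>a. a \<in> A \<Longrightarrow> a < M"
  shows "(\<Sum>r\<in>permutations_of_multiset (mset_set A + replicate_mset k M). inv_weight \<phi> r)
    = (\<Sum>r\<in>permutations_of_multiset (mset_set A). inv_weight (max_op (Suc k) \<phi>) r)"
proof -
  have *: "M \<notin># mset_set A" using assms by auto
  show ?thesis unfolding sum_permutations_insertions[OF *]
  proof (intro sum.cong refl sum_insertions)
    fix w a assume "w \<in> permutations_of_multiset (mset_set A)" "a \<in> set w"
    then show "a < M" using assms
      by (metis finite_set_mset_mset_set permutations_of_multisetD set_mset_mset)
  qed
qed

text \<open>The elements are inserted from the smallest up, each as a single maximal letter.\<close>

lemma sum_inv_weight_permutations_set: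
  fixes A :: "'b::linorder set"
  assumes "finite A"
  shows "(\<Sum>r\<in>permutations_of_multiset (mset_set A). inv_weight \<phi> r) = (single_op ^^ card A) \<phi> 0"
  using assms
proof (induction A arbitrary: \<phi> rule: finite_linorder_max_induct)
  case (insert x A)
  have "x \<notin> A" using insert.hyps by auto
  then have "mset_set (insert x A) = mset_set A + replicate_mset 1 x" using insert.hyps by simp
  then show ?case
    using sum_inv_weight_permutations[of A x \<phi> 1] insert \<open>x \<notin> A\<close>
    by (simp add: max_op_single[abs_def] funpow_swap1)
qed simp

lemma sum_inv_weight_eq_sum_maj_weight:
  fixes M :: "'b::linorder"
  assumes "finite A" "\<And>a. a \<in> A \<Longrightarrow> a < M"
  shows "(\<Sum>r\<in>permutations_of_multiset (mset_set A + replicate_mset k M). inv_weight \<phi> r)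
    = (\<Sum>r\<in>permutations_of_multiset (mset_set A + replicate_mset k M). maj_weight (des_weight \<phi> (card A + k)) r)"
  using assms by (simp add: sum_maj_weight_permutations sum_inv_weight_permutations sum_inv_weight_permutations_set max_op_funpow[symmetric])

section \<open>From the weights back to the statistics of words\<close>

lemma inv_box_snoc: "i \<le> length w \<Longrightarrow> inv_box i (w @ [x]) = inv_box i w"
  by (auto simp: inv_box_def letter_def nth_append intro!: arg_cong[where f = card])

lemma inv_box_last: "inv_box (Suc (length w)) (w @ [x]) = length (filter (\<lambda>a. a > x) (rev w))"
proof -
  have "inv_box (Suc (length w)) (w @ [x]) = card {j. 1 \<le> j \<and> j < Suc (length w) \<and> w ! (j - 1) > x}"
    by (auto simp: inv_box_def letter_def nth_append intro!: arg_cong[where f = card])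
  also have "\<dots> = card {i. i < length w \<and> w ! i > x}"
    by (rule bij_betw_same_card[of "\<lambda>j. j - 1"], rule bij_betw_byWitness[where f' = Suc]) auto
  also have "\<dots> = length (filter (\<lambda>a. a > x) (rev w))"
    by (simp add: length_filter_conv_card flip: rev_filter)
  finally show ?thesis .
qed

lemma inv0_snoc: "inv0 (w @ [x]) = inv0 w + length (filter (\<lambda>a. a > x) (rev w))"
  by (simp add: inv0_def inv_box_snoc inv_box_last)

lemma Des_snoc: "Des (w @ [x]) = Des w \<union> (if w \<noteq> [] \<and> last w > x then {length w} else {})"
  by (cases "w = []") (auto simp: Des_def letter_def nth_append last_conv_nth less_Suc_eq)

lemma Des_Nil [simp]: "Des [] = {}"
  by (simp add: Des_def)

lemma Des_less: "i \<in> Des w \<Longrightarrow> i < length w"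
  by (simp add: Des_def)

text \<open>For constant weight 1 the sum over block partitions factors over the descents: cutting
  at a descent \<open>i\<close> keeps the factor \<open>q ^ inv_box i w\<close>, joining replaces it
  by \<open>y\<close>.\<close>

lemma inv_weight_rev:
  "inv_weight (\<lambda>_. 1) (rev w) = q ^ inv0 w * (\<Prod>i\<in>Des w. 1 + q * y / q ^ (1 + inv_box i w))"
proof (induction w rule: rev_induct)
  case Nil
  show ?case by (simp add: inv0_def Des_def)
next
  case (snoc x w)
  let ?I = "\<lambda>r x. length (filter (\<lambda>a. a > x) r)"
  have "(\<Prod>i\<in>Des (w @ [x]). 1 + q * y / q ^ (1 + inv_box i (w @ [x])))
      = (\<Prod>i\<in>Des w. 1 + q * y / q ^ (1 + inv_box i w))
        * (if w \<noteq> [] \<and> last w > x then 1 + q * y / q ^ (1 + inv_box (length w) w) else 1)"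
  proof -
    have "(\<Prod>i\<in>Des w. 1 + q * y / q ^ (1 + inv_box i (w @ [x])))
      = (\<Prod>i\<in>Des w. 1 + q * y / q ^ (1 + inv_box i w))"
      by (intro prod.cong refl) (auto simp: inv_box_snoc dest: Des_less)
    moreover have "length w \<notin> Des w" by (auto dest: Des_less)
    ultimately show ?thesis by (simp add: Des_snoc finite_Des inv_box_snoc mult.commute)
  qed
  moreover have "inv_weight_last (\<lambda>_. 1) x (rev w) = inv_weight (\<lambda>_. 1) (rev w)
      * (if w \<noteq> [] \<and> last w > x then 1 + q * y / q ^ (1 + inv_box (length w) w) else 1)"
  proof (cases w rule: rev_cases)
    case (snoc u a)
    then show ?thesis using q_nonzero by (simp add: inv_box_last o_def field_simps)
  qed simp
  ultimately show ?case using snoc.IH by (simp add: inv0_snoc power_add)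
qed

lemma maj_weight_rev: "maj_weight \<psi> (rev w) = q ^ maj0 w * \<psi> (des w)"
proof (induction w arbitrary: \<psi> rule: rev_induct)
  case Nil
  show ?case by (simp add: maj0_def des_def Des_def)
next
  case (snoc x w)
  show ?case
  proof (cases w rule: rev_cases)
    case Nil
    then show ?thesis using Des_snoc[of "[]" x] by (simp add: maj0_def des_def)
  next
    case (snoc u a)
    have "length w \<notin> Des w" by (auto dest: Des_less)
    then have "maj0 (w @ [x]) = maj0 w + (if w \<noteq> [] \<and> last w > x then length w else 0)"
      and "des (w @ [x]) = des w + (if w \<noteq> [] \<and> last w > x then 1 else 0)"
      by (simp_all add: maj0_def des_def Des_snoc finite_Des)
    then show ?thesis using snoc.IH by (simp add: snoc power_add)
  qed
qed

lemma sum_words_inv_eq_maj: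
  fixes k :: nat and M :: enat
  assumes "finite A" "\<And>a. a \<in> A \<Longrightarrow> a < M"
  defines "P \<equiv> permutations_of_multiset (mset_set A + replicate_mset k M)"
  shows "(\<Sum>w\<in>P. q ^ inv0 w * (\<Prod>i\<in>Des w. 1 + q * y / q ^ (1 + inv_box i w)))
    = (\<Sum>w\<in>P. q ^ maj0 w * (\<Prod>i=1..des w. 1 + q * y / q ^ i))"
proof -
  \<comment> \<open>The weights read words backwards, and \<open>P\<close> is closed under
    reversal.\<close>
  have rev_P: "bij_betw rev P P"
    by (rule bij_betw_byWitness[where f' = rev]) (auto simp: P_def permutations_of_multiset_def)
  have "(\<Sum>w\<in>P. q ^ inv0 w * (\<Prod>i\<in>Des w. 1 + q * y / q ^ (1 + inv_box i w))) = (\<Sum>w\<in>P. inv_weight (\<lambda>_. 1) w)"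
    unfolding inv_weight_rev[symmetric] by (rule sum.reindex_bij_betw[OF rev_P])
  also have "\<dots> = (\<Sum>w\<in>P. maj_weight (des_weight (\<lambda>_. 1) (card A + k)) w)"
    unfolding P_def by (rule sum_inv_weight_eq_sum_maj_weight) fact+
  also have "\<dots> = (\<Sum>w\<in>P. q ^ maj0 w * (\<Prod>i=1..des w. 1 + q * y / q ^ i))"
    unfolding des_weight_1[of "card A + k", symmetric] maj_weight_rev[symmetric] by (rule sum.reindex_bij_betw[OF rev_P, symmetric])
  finally show ?thesis .
qed

end

section \<open>Partial permutations grouped by their set of numbers\<close>

lemma partial_perms_num_letters:
  assumes "S \<subseteq> {1..n}" "card S + k = n"
  shows "{\<pi> \<in> partial_perms n k. num_letters \<pi> = S}
    = permutations_of_multiset (mset_set (enat ` S) + replicate_mset k hole)"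
proof (intro equalityI subsetI)
  have fin: "finite S" using assms finite_subset by blast
  {
    fix \<pi> assume "\<pi> \<in> {\<pi> \<in> partial_perms n k. num_letters \<pi> = S}"
    then have \<pi>: "count_list \<pi> hole = k" "distinct (filter (\<lambda>x. x \<noteq> hole) \<pi>)" "num_letters \<pi> = S"
      by (auto simp: partial_perms_def)
    have "set (filter (\<lambda>x. x \<noteq> hole) \<pi>) = enat ` S"
      using \<pi>(3) by (auto simp: num_letters_def)
    then have "filter_mset (\<lambda>x. x \<noteq> hole) (mset \<pi>) = mset_set (enat ` S)"
      using \<pi>(2) by (metis mset_filter mset_set_set)
    moreover have "mset \<pi> = filter_mset (\<lambda>x. x \<noteq> hole) (mset \<pi>) + replicate_mset k hole"
      using \<pi>(1) by (intro multiset_eqI) (auto simp: count_mset)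
    ultimately show "\<pi> \<in> permutations_of_multiset (mset_set (enat ` S) + replicate_mset k hole)"
      by (simp add: permutations_of_multiset_def)
  }
  fix \<pi> assume "\<pi> \<in> permutations_of_multiset (mset_set (enat ` S) + replicate_mset k hole)"
  then have m: "mset \<pi> = mset_set (enat ` S) + replicate_mset k hole"
    by (simp add: permutations_of_multiset_def)
  have hole: "hole \<notin> enat ` S" by auto
  have "length \<pi> = card S + k"
    using arg_cong[OF m, of size] by (simp add: card_image inj_on_def)
  moreover have "set \<pi> = enat ` S \<union> (if k = 0 then {} else {hole})"
    using arg_cong[OF m, of set_mset] fin by auto
  moreover have "count_list \<pi> hole = k"
    using arg_cong[OF m, of "\<lambda>X. count X hole"] hole by (simp add: count_mset)
  moreover have "distinct (filter (\<lambda>x. x \<noteq> hole) \<pi>)"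
  proof -
    have "filter_mset (\<lambda>x. x \<noteq> hole) (mset_set (enat ` S) + replicate_mset k hole) = mset_set (enat ` S)"
      using hole by (intro multiset_eqI) auto
    then have f: "mset (filter (\<lambda>x. x \<noteq> hole) \<pi>) = mset_set (enat ` S)"
      by (metis m mset_filter)
    have "set (filter (\<lambda>x. x \<noteq> hole) \<pi>) = enat ` S"
      using arg_cong[OF f, of set_mset] fin unfolding set_mset_mset by simp
    moreover have "length (filter (\<lambda>x. x \<noteq> hole) \<pi>) = card (enat ` S)"
      using arg_cong[OF f, of size] unfolding size_mset by simp
    ultimately show ?thesis by (metis card_distinct)
  qed
  ultimately show "\<pi> \<in> {\<pi> \<in> partial_perms n k. num_letters \<pi> = S}"
    using assms by (auto simp: partial_perms_def num_letters_def)
qed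

lemma num_letters_partial_perms:
  assumes "\<pi> \<in> partial_perms n k"
  shows "num_letters \<pi> \<subseteq> {1..n}" "card (num_letters \<pi>) + k = n"
proof -
  have \<pi>: "length \<pi> = n" "set \<pi> \<subseteq> insert hole (enat ` {1..n})" "count_list \<pi> hole = k"
    "distinct (filter (\<lambda>x. x \<noteq> hole) \<pi>)" using assms by (auto simp: partial_perms_def)
  show "num_letters \<pi> \<subseteq> {1..n}" using \<pi>(2) by (auto simp: num_letters_def)
  have "enat ` num_letters \<pi> = set (filter (\<lambda>x. x \<noteq> hole) \<pi>)"
    by (auto simp: num_letters_def)
  then have "card (num_letters \<pi>) = length (filter (\<lambda>x. x \<noteq> hole) \<pi>)"
    using \<pi>(4) by (metis card_image distinct_card enat.inject inj_onI)
  moreover have "length (filter (\<lambda>x. x \<noteq> hole) \<pi>) + count_list \<pi> hole = length \<pi>"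
    by (induction \<pi>) auto
  ultimately show "card (num_letters \<pi>) + k = n" using \<pi> by simp
qed

theorem theorem2p2:
  fixes n k :: nat
  assumes "k \<le> n"
  shows "(\<Sum>\<pi>\<in>partial_perms n k.
            q_var ^ inv_stat \<pi> * (\<Prod>i\<in>Des \<pi>. 1 + z_var / q_var ^ (1 + inv_box i \<pi>)))
       = (\<Sum>\<pi>\<in>partial_perms n k.
            q_var ^ maj_stat \<pi> * (\<Prod>i=1..des \<pi>. 1 + z_var / q_var ^ i))"
proof -
  have q: "q_var \<noteq> 0" by (simp add: q_var_def Zero_fract_def eq_fract)
  define y where "y = z_var / q_var"
  have z: "z_var = q_var * y" using q by (simp add: y_def)
  interpret q_weights q_var y by standard (rule q)
  define \<S> where "\<S> = {S. S \<subseteq> {1..n} \<and> card S + k = n}"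
  have split: "sum h (partial_perms n k) = (\<Sum>S\<in>\<S>. \<Sum>\<pi> | \<pi> \<in> partial_perms n k \<and> num_letters \<pi> = S. h \<pi>)"
    for h :: "word \<Rightarrow> ratfun"
  proof (rule sum.group[symmetric])
    show "finite \<S>" by (rule finite_subset[of _ "Pow {1..n}"]) (auto simp: \<S>_def)
  qed (use num_letters_partial_perms in \<open>auto simp: \<S>_def finite_partial_perms\<close>)
  show ?thesis unfolding split
  proof (rule sum.cong[OF refl])
    fix S assume "S \<in> \<S>"
    then have S: "S \<subseteq> {1..n}" "card S + k = n" by (auto simp: \<S>_def)
    define P where "P = {\<pi> \<in> partial_perms n k. num_letters \<pi> = S}"
    \<comment> \<open>This depends only on \<open>S\<close>, so it leaves both sums as a common
      power of \<open>q_var\<close>.\<close>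
    define c where "c = inv_sets S ({1..n} - S)"
    have c: "inv_sets (num_letters \<pi>) (missing_letters \<pi>) = c" if "\<pi> \<in> P" for \<pi>
      using that by (auto simp: P_def c_def missing_letters_def partial_perms_def)
    have P: "P = permutations_of_multiset (mset_set (enat ` S) + replicate_mset k hole)"
      unfolding P_def by (rule partial_perms_num_letters) fact+
    have "finite (enat ` S)" using S(1) finite_subset by blast
    then have eq: "(\<Sum>\<pi>\<in>P. q_var ^ inv0 \<pi> * (\<Prod>i\<in>Des \<pi>. 1 + z_var / q_var ^ (1 + inv_box i \<pi>)))
      = (\<Sum>\<pi>\<in>P. q_var ^ maj0 \<pi> * (\<Prod>i=1..des \<pi>. 1 + z_var / q_var ^ i))"
      unfolding P z by (rule sum_words_inv_eq_maj) auto
    have "(\<Sum>\<pi>\<in>P. q_var ^ inv_stat \<pi> * (\<Prod>i\<in>Des \<pi>. 1 + z_var / q_var ^ (1 + inv_box i \<pi>)))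
      = q_var ^ c * (\<Sum>\<pi>\<in>P. q_var ^ inv0 \<pi> * (\<Prod>i\<in>Des \<pi>. 1 + z_var / q_var ^ (1 + inv_box i \<pi>)))"
      unfolding sum_distrib_left by (intro sum.cong refl) (simp add: inv_stat_def c power_add)
    also have "\<dots> = (\<Sum>\<pi>\<in>P. q_var ^ maj_stat \<pi> * (\<Prod>i=1..des \<pi>. 1 + z_var / q_var ^ i))"
      unfolding eq sum_distrib_left by (intro sum.cong refl) (simp add: maj_stat_def c power_add)
    finally show "(\<Sum>\<pi> | \<pi> \<in> partial_perms n k \<and> num_letters \<pi> = S.
        q_var ^ inv_stat \<pi> * (\<Prod>i\<in>Des \<pi>. 1 + z_var / q_var ^ (1 + inv_box i \<pi>)))
      = (\<Sum>\<pi> | \<pi> \<in> partial_perms n k \<and> num_letters \<pi> = S.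
        q_var ^ maj_stat \<pi> * (\<Prod>i=1..des \<pi>. 1 + z_var / q_var ^ i))"
      unfolding P_def .
  qed
qed

end
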